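(* Let $F=(V,E)$ be a public graph topology with $n$ vertices and $m$ edges such that $d_{\max}(F)\ge 8$ and $\phi(F)\ge\max\{8n,\ 10000\, d_{\max}(F)\log_2 n\}$. Let $R>0$ and suppose $\mathcal{A}_{\mathsf{HC}}$ is a (randomized) hierarchical clustering algorithm with expected additive error at most $R\cdot\frac{n\,\phi(F)}{400\, d_{\max}(F)}$. Then the reconstruction attack $\mathsf{Rec}^{\mathsf{HC}}$ (instantiated with $F$, $R$ and $\mathcal{A}_{\mathsf{HC}}$) satisfies $\operatorname{Succ}(\mathsf{Rec}^{\mathsf{HC}})\ge 0.4$. Furthermore, the expected size of the reconstructed set satisfies $\mathbb{E}[|I|]\ge \frac{\phi(F)}{8\, d_{\max}(F)}$.
   Context: Graphs are finite, simple, undirected and connected, with $m>n$. $d_{\max}(F)$ is the maximum degree of $F$. A balanced cut is a partition $V=A\sqcup B$ with $\frac n3\le|A|,|B|\le\frac{2n}3$. For $E''\subseteq E$, $E''(A,B)$ is the set of edges of $E''$ with one endpoint in $A$ and the other in $B$, and $w(A,B)=\sum_{e\in E(A,B)}w(e)$. $\phi(F)=\min|E(A,B)|$ over all balanced cuts $(A,B)$. A hierarchical clustering is a rooted binary tree $T$ whose leaves are in bijection with $V$. For $w:E\to\mathbb{R}_{\ge0}$, its (Dasgupta) cost is $\mathrm{cost}_w(T)=\sum_{\{u,v\}\in E}|T[u\vee v]|\,w(\{u,v\})$, where $|T[u\vee v]|$ is the number of leaves in the subtree rooted at the lowest common ancestor of $u$ and $v$. A hierarchical clustering algorithm takes $(F,w)$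 and outputs such a tree $T$; it has expected additive error at most $\eta$ if $\mathbb{E}[\mathrm{cost}_w(T)]\le\min_{T'}\mathrm{cost}_w(T')+\eta$ for every $w$. $\mathsf{HCToBC}$ is a deterministic procedure which takes a hierarchical clustering $T$ (and not $w$) and outputs a balanced cut $(A,B)$ such that $\frac{w(A,B)}{|A||B|}\le\frac{27}{4n^3}\mathrm{cost}_w(T)$ for every $w:E\to\mathbb{R}_{\ge0}$ (such a procedure exists by a lemma of Dasgupta). The attack $\mathsf{Rec}^{\mathsf{HC}}$ on input $\mathbf{x}\in\{0,1\}^m$: (1) sample $E'\subseteq E$ by including each edge independently with probability $p=\frac{0.5}{d_{\max}(F)}$; let $k=|E'|$ and $\ell:E'\to[k]$ be an arbitrary bijection. (2) Set $w(e)=R\cdot x_{\ell(e)}$ for $e\in E'$ and $w(e)=0$ for $e\in E\setminus E'$. (3) Compute $T=\mathcal{A}_{\mathsf{HC}}(F,w)$ and $(A,B)=\mathsf{HCToBC}(T)$. (4) Output $I=\{\ell(e):e\in E'(A,B)\}$ and the guesses $y_i=0$ for all $i\in I$. The success of an attack which on input $\mathbf{x}$ outputs $(I,\mathbf{y})$ is $\operatorname{Succ}=\frac12-\frac{\mathbb{E}[|\{i\in I:x_i\ne y_i\}|]}{\mathbb{E}[|I|]}$, where $\mathbf{x}$ is uniform in $\{0,1\}^m$ and expectations are over $\mathbf{x}$ and all randomness of the attack (the sampling of $E'$, $\mathbf{x}$ and the internal randomness of $\mathcal{A}_{\mathsf{HC}}$ are independent). *)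

theory Defs
  imports "HOL-Probability.Probability"
begin

text \<open>A graph is given by its vertex set \<open>V\<close> and its set \<open>E\<close> of two-element edges.\<close>

definition connected_simple_graph :: "'v set \<Rightarrow> 'v set set \<Rightarrow> bool" where
  "connected_simple_graph V E \<longleftrightarrow>
     finite V \<and> V \<noteq> {} \<and>
     (\<forall>e\<in>E. e \<subseteq> V \<and> card e = 2) \<and>
     (\<forall>u\<in>V. \<forall>v\<in>V. (u, v) \<in> {(a, b). {a, b} \<in> E}\<^sup>*)"

definition vertex_degree :: "'v set set \<Rightarrow> 'v \<Rightarrow> nat" where
  "vertex_degree E v = card {e\<in>E. v \<in> e}"

definition max_degree :: "'v set \<Rightarrow> 'v set set \<Rightarrow> nat" where
  "max_degree V E = Max (vertex_degree E ` V)"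

definition balanced_cut :: "'v set \<Rightarrow> 'v set \<Rightarrow> 'v set \<Rightarrow> bool" where
  "balanced_cut V A B \<longleftrightarrow>
     A \<union> B = V \<and> A \<inter> B = {} \<and>
     real (card V) / 3 \<le> real (card A) \<and> real (card A) \<le> 2 * real (card V) / 3 \<and>
     real (card V) / 3 \<le> real (card B) \<and> real (card B) \<le> 2 * real (card V) / 3"

definition cut_edges :: "'v set set \<Rightarrow> 'v set \<Rightarrow> 'v set \<Rightarrow> 'v set set" where
  "cut_edges E A B = {e\<in>E. \<exists>a\<in>A. \<exists>b\<in>B. e = {a, b}}"

definition cut_weight :: "'v set set \<Rightarrow> ('v set \<Rightarrow> real) \<Rightarrow> 'v set \<Rightarrow> 'v set \<Rightarrow> real" where
  "cut_weight E w A B = (\<Sum>e\<in>cut_edges E A B. w e)"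

definition min_balanced_cut :: "'v set \<Rightarrow> 'v set set \<Rightarrow> nat" where
  "min_balanced_cut V E = Min {card (cut_edges E A B) | A B. balanced_cut V A B}"

text \<open>Weight functions \<open>E \<rightarrow> \<real>\<^sub>\<ge>\<^sub>0\<close>, as extensional functions so that a weight function
  carries no information outside \<open>E\<close>.\<close>

definition edge_weights :: "'v set set \<Rightarrow> ('v set \<Rightarrow> real) set" where
  "edge_weights E = E \<rightarrow>\<^sub>E {0..}"

datatype 'v hc_tree = HLeaf 'v | HNode "'v hc_tree" "'v hc_tree"

fun leaf_list :: "'v hc_tree \<Rightarrow> 'v list" where
  "leaf_list (HLeaf v) = [v]"
| "leaf_list (HNode l r) = leaf_list l @ leaf_list r"

definition hierarchical_clusterings :: "'v set \<Rightarrow> 'v hc_tree set" where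
  "hierarchical_clusterings V = {T. distinct (leaf_list T) \<and> set (leaf_list T) = V}"

text \<open>For \<open>S\<close> a set of leaves of \<open>T\<close>, the subtree of \<open>T\<close> rooted at the lowest common
  ancestor of \<open>S\<close>; in particular \<open>lca_subtree T {u, v}\<close> is \<open>T[u \<or> v]\<close>.\<close>

fun lca_subtree :: "'v hc_tree \<Rightarrow> 'v set \<Rightarrow> 'v hc_tree" where
  "lca_subtree (HLeaf v) S = HLeaf v"
| "lca_subtree (HNode l r) S =
     (if S \<subseteq> set (leaf_list l) then lca_subtree l S
      else if S \<subseteq> set (leaf_list r) then lca_subtree r S
      else HNode l r)"

definition hc_cost :: "'v set set \<Rightarrow> ('v set \<Rightarrow> real) \<Rightarrow> 'v hc_tree \<Rightarrow> real" where
  "hc_cost E w T = (\<Sum>e\<in>E. real (length (leaf_list (lca_subtree T e))) * w e)"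

text \<open>A randomized algorithm maps \<open>(V, E)\<close> and \<open>w\<close> to the distribution of its output. As there
  are only finitely many hierarchical clusterings of \<open>V\<close>, using a \<open>pmf\<close> is no restriction.\<close>

type_synonym 'v hc_algorithm = "'v set \<Rightarrow> 'v set set \<Rightarrow> ('v set \<Rightarrow> real) \<Rightarrow> 'v hc_tree pmf"

definition is_hc_algorithm_on :: "'v set \<Rightarrow> 'v set set \<Rightarrow> 'v hc_algorithm \<Rightarrow> bool" where
  "is_hc_algorithm_on V E \<A> \<longleftrightarrow>
     (\<forall>w\<in>edge_weights E. set_pmf (\<A> V E w) \<subseteq> hierarchical_clusterings V)"

definition expected_additive_error_le ::
    "'v set \<Rightarrow> 'v set set \<Rightarrow> 'v hc_algorithm \<Rightarrow> real \<Rightarrow> bool" where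
  "expected_additive_error_le V E \<A> \<eta> \<longleftrightarrow>
     (\<forall>w\<in>edge_weights E.
        measure_pmf.expectation (\<A> V E w) (hc_cost E w)
          \<le> Min (hc_cost E w ` hierarchical_clusterings V) + \<eta>)"

text \<open>The specification of the procedure \<open>HCToBC\<close>. The cut is a function of the tree alone, and
  the same cut has to satisfy the inequality for all weight functions.\<close>

definition is_HCToBC ::
    "'v set \<Rightarrow> 'v set set \<Rightarrow> ('v hc_tree \<Rightarrow> 'v set \<times> 'v set) \<Rightarrow> bool" where
  "is_HCToBC V E H \<longleftrightarrow>
     (\<forall>T\<in>hierarchical_clusterings V. \<forall>A B. H T = (A, B) \<longrightarrow>
        balanced_cut V A B \<and>
        (\<forall>w\<in>edge_weights E.
           cut_weight E w A B / (real (card A) * real (card B))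
             \<le> 27 / (4 * real (card V) ^ 3) * hc_cost E w T))"

text \<open>An attack maps an input \<open>x\<close> to the distribution of its output \<open>(I, y)\<close>; only the values
  of \<open>y\<close> on \<open>I\<close> matter.\<close>

type_synonym attack = "(nat \<Rightarrow> nat) \<Rightarrow> (nat set \<times> (nat \<Rightarrow> nat)) pmf"

definition bit_strings :: "nat \<Rightarrow> (nat \<Rightarrow> nat) set" where
  "bit_strings m = {1..m} \<rightarrow>\<^sub>E {0, 1}"

definition attack_experiment ::
    "nat \<Rightarrow> attack \<Rightarrow> ((nat \<Rightarrow> nat) \<times> nat set \<times> (nat \<Rightarrow> nat)) pmf" where
  "attack_experiment m Att =
     do {
       x \<leftarrow> pmf_of_set (bit_strings m);
       (I, y) \<leftarrow> Att x;
       return_pmf (x, I, y)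
     }"

definition expected_size :: "nat \<Rightarrow> attack \<Rightarrow> real" where
  "expected_size m Att =
     measure_pmf.expectation (attack_experiment m Att) (\<lambda>(x, I, y). real (card I))"

definition expected_errors :: "nat \<Rightarrow> attack \<Rightarrow> real" where
  "expected_errors m Att =
     measure_pmf.expectation (attack_experiment m Att)
       (\<lambda>(x, I, y). real (card {i\<in>I. x i \<noteq> y i}))"

definition Succ_attack :: "nat \<Rightarrow> attack \<Rightarrow> real" where
  "Succ_attack m Att = 1 / 2 - expected_errors m Att / expected_size m Att"

definition sample_edges :: "'v set set \<Rightarrow> real \<Rightarrow> 'v set set pmf" where
  "sample_edges E p =
     map_pmf (\<lambda>b. {e\<in>E. b e}) (Pi_pmf E False (\<lambda>_. bernoulli_pmf p))"

text \<open>\<open>lab E'\<close> is the arbitrary bijection \<open>E' \<rightarrow> {1..card E'}\<close> used when \<open>E'\<close> has been sampled.\<close>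

definition is_labelling :: "'v set set \<Rightarrow> ('v set set \<Rightarrow> 'v set \<Rightarrow> nat) \<Rightarrow> bool" where
  "is_labelling E lab \<longleftrightarrow> (\<forall>E'. E' \<subseteq> E \<longrightarrow> bij_betw (lab E') E' {1..card E'})"

definition attack_weights ::
    "'v set set \<Rightarrow> real \<Rightarrow> (nat \<Rightarrow> nat) \<Rightarrow> 'v set set \<Rightarrow> ('v set \<Rightarrow> nat) \<Rightarrow> 'v set \<Rightarrow> real" where
  "attack_weights E R x E' l = (\<lambda>e\<in>E. if e \<in> E' then R * real (x (l e)) else 0)"

definition Rec_HC ::
    "'v set \<Rightarrow> 'v set set \<Rightarrow> real \<Rightarrow> 'v hc_algorithm \<Rightarrow> ('v hc_tree \<Rightarrow> 'v set \<times> 'v set)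
      \<Rightarrow> ('v set set \<Rightarrow> 'v set \<Rightarrow> nat) \<Rightarrow> attack" where
  "Rec_HC V E R \<A> H lab x =
     do {
       E' \<leftarrow> sample_edges E (0.5 / real (max_degree V E));
       T \<leftarrow> \<A> V E (attack_weights E R x E' (lab E'));
       let (A, B) = H T;
       return_pmf (lab E' ` cut_edges E' A B, \<lambda>_. 0)
     }"

end

theory Submission
  imports Defs
begin

text \<open>
  Put \<open>d = max_degree V E\<close>, \<open>q = 1 / (4 * d)\<close>, and let \<open>G\<close> be the set of sampled edges whose bit
  is 1. The algorithm sees only \<open>G\<close>, which contains each edge independently with probability
  \<open>q\<close>. Given \<open>G\<close>, every edge of \<open>E\<close> still lies in \<open>E'\<close> with probability at least \<open>q\<close>, so
  whatever balanced cut is output, the expected size of \<open>I\<close> is at least \<open>q\<close> times the minimum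
  balanced cut; no concentration over all cuts is needed.

  The errors are the cut edges of \<open>G\<close>, whose number \<open>HCToBC\<close> bounds by the cost of the tree.
  An optimal tree costs at most as much as one that first separates the components of \<open>G\<close>,
  namely at most \<open>R\<close> times the number of pairs of an edge of \<open>G\<close> and a vertex in its component.
  Such a pair determines a simple path of \<open>G\<close> that starts with this edge and ends in this vertex.
  There are at most \<open>n * d ^ k\<close> simple paths with \<open>k\<close> edges, each contained in \<open>G\<close> with
  probability \<open>q ^ k\<close>, so this number of pairs has expectation at most
  \<open>n * (\<Sum>k\<ge>1. (1 / 4) ^ k) = n / 3\<close>.
\<close>

section \<open>Power sums over subsets\<close>

text \<open>Expanding the product of \<open>card A\<close> factors \<open>a + b\<close>, a subset
  \<open>U\<close> records the factors from which \<open>a\<close> is taken.\<close>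

lemma sum_Pow_power_card:
  fixes a b :: "'a::comm_ring_1"
  assumes "finite A"
  shows "(\<Sum>U\<in>Pow A. a ^ card U * b ^ (card A - card U)) = (a + b) ^ card A"
proof -
  have "(\<Sum>U\<in>Pow A. a ^ card U * b ^ (card A - card U))
      = (\<Sum>U\<in>Pow A. (\<Prod>x\<in>U. a) * (\<Prod>x\<in>A - U. b))"
    using assms by (intro sum.cong) (auto simp: card_Diff_subset finite_subset)
  also have "\<dots> = (\<Prod>x\<in>A. a + b)"
    using assms by (rule prod_add[symmetric])
  finally show ?thesis by simp
qed

text \<open>Only the elements outside \<open>S\<close> are free, so the binomial theorem applies on
  \<open>E - S\<close>. The sum \<open>a + b\<close> is kept general: besides \<open>q\<close> and
  \<open>1 - q\<close>, the pair \<open>p / 2\<close> and \<open>1 - p\<close> is needed, whose sum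
  is not 1.\<close>

lemma sum_supersets_power_card:
  fixes a b :: "'a::comm_ring_1"
  assumes fin: "finite E" and S: "S \<subseteq> E"
  shows "(\<Sum>G | S \<subseteq> G \<and> G \<subseteq> E. a ^ card G * b ^ (card E - card G))
    = a ^ card S * (a + b) ^ (card E - card S)"
proof -
  have finS: "finite S" using fin S by (rule rev_finite_subset)
  have cE: "card (E - S) = card E - card S"
    using finS S by (rule card_Diff_subset)
  have "(\<Sum>G | S \<subseteq> G \<and> G \<subseteq> E. a ^ card G * b ^ (card E - card G))
      = (\<Sum>U\<in>Pow (E - S). a ^ card S * (a ^ card U * b ^ (card (E - S) - card U)))"
  proof (rule sum.reindex_bij_witness[where i = "\<lambda>U. S \<union> U" and j = "\<lambda>G. G - S"], goal_cases)
    case (5 G)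
    then have "card (G - S) = card G - card S" "card S \<le> card G" "card G \<le> card E"
      using fin finS by (auto simp: card_Diff_subset intro: card_mono finite_subset)
    then show ?case
      by (simp add: cE flip: mult.assoc power_add)
  qed (use S in auto)
  also have "\<dots> = a ^ card S * (a + b) ^ card (E - S)"
    using fin by (simp add: sum_distrib_left[symmetric] sum_Pow_power_card)
  finally show ?thesis by (simp add: cE)
qed

section \<open>Simple paths\<close>

fun path_edges :: "'v list \<Rightarrow> 'v set set" where
  "path_edges (a # b # xs) = insert {a, b} (path_edges (b # xs))"
| "path_edges _ = {}"

lemma path_edges_subset: "e \<in> path_edges xs \<Longrightarrow> e \<subseteq> set xs"
  by (induction xs rule: path_edges.induct) auto

text \<open>A single vertex is a path without edges, hence the bound on the length. This places the
  vertices of a path in \<open>V\<close> once its edges are known to be edges of the graph.\<close>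

lemma set_subset_Union_path_edges: "2 \<le> length xs \<Longrightarrow> set xs \<subseteq> \<Union>(path_edges xs)"
proof (induction xs rule: path_edges.induct)
  case (1 a b xs)
  then show ?case by (cases xs) auto
qed auto

lemma finite_path_edges [simp]: "finite (path_edges xs)"
  by (induction xs rule: path_edges.induct) auto

text \<open>The first edge contains the first vertex, which no later edge of a distinct list can
  contain. The exact count makes a path with \<open>k\<close> edges survive with probability exactly
  \<open>q ^ k\<close>.\<close>

lemma card_path_edges: "distinct xs \<Longrightarrow> card (path_edges xs) = length xs - 1"
proof (induction xs rule: path_edges.induct)
  case (1 a b xs)
  have "{a, b} \<notin> path_edges (b # xs)"
    using path_edges_subset[of "{a, b}" "b # xs"] "1.prems" by auto
  then show ?case using 1 by simp
qed auto

lemma path_edges_append_subset: "path_edges ys \<subseteq> path_edges (xs @ ys)"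
proof (induction xs)
  case (Cons x xs)
  then show ?case by (cases "xs @ ys") auto
qed simp

text \<open>The index \<open>k\<close> counts edges, so the vertex list has length
  \<open>Suc k\<close>. Lists carry a direction: for \<open>k \<ge> 1\<close> a path and its
  reversal are counted separately.\<close>

definition simple_paths :: "'v set \<Rightarrow> 'v set set \<Rightarrow> nat \<Rightarrow> 'v list set" where
  "simple_paths V E k =
     {xs. length xs = Suc k \<and> distinct xs \<and> set xs \<subseteq> V \<and> path_edges xs \<subseteq> E}"

lemma finite_simple_paths: "finite V \<Longrightarrow> finite (simple_paths V E k)"
  by (rule finite_subset[OF _ finite_lists_length_eq[of V "Suc k"]])
     (auto simp: simple_paths_def)

text \<open>Sending a neighbour \<open>v\<close> to the edge \<open>{v, u}\<close> is injective into
  the edges at \<open>u\<close>.\<close>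

lemma card_neighbours_le:
  assumes "finite V" "finite E" "u \<in> V"
  shows "card (V \<inter> {v. {v, u} \<in> E}) \<le> max_degree V E"
proof -
  have "card (V \<inter> {v. {v, u} \<in> E}) \<le> card {e\<in>E. u \<in> e}"
    using assms by (intro card_inj_on_le[of "\<lambda>v. {v, u}"]) (auto simp: inj_on_def doubleton_eq_iff)
  also have "\<dots> \<le> max_degree V E"
    unfolding max_degree_def vertex_degree_def using assms by (intro Max_ge) auto
  finally show ?thesis .
qed

text \<open>A path with \<open>k + 1\<close> edges is a path with \<open>k\<close> edges preceded by
  a neighbour of its head, and at most \<open>max_degree V E\<close> vertices qualify as that
  neighbour.\<close>

lemma card_simple_paths_le:
  assumes "finite V" "finite E"
  shows "card (simple_paths V E k) \<le> card V * max_degree V E ^ k"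
proof (induction k)
  case 0
  have "simple_paths V E 0 \<subseteq> (\<lambda>v. [v]) ` V"
    by (auto simp: simple_paths_def length_Suc_conv)
  then have "card (simple_paths V E 0) \<le> card ((\<lambda>v. [v]) ` V)"
    using assms by (intro card_mono) auto
  also have "\<dots> \<le> card V"
    using assms by (intro card_image_le)
  finally show ?case by simp
next
  case (Suc k)
  let ?N = "\<lambda>xs. {v. {v, hd xs} \<in> E}"
  have "simple_paths V E (Suc k) \<subseteq> (\<Union>xs\<in>simple_paths V E k. (\<lambda>v. v # xs) ` (V \<inter> ?N xs))"
  proof
    fix ys assume "ys \<in> simple_paths V E (Suc k)"
    moreover from this obtain v u xs where "ys = v # u # xs"
      by (auto simp: simple_paths_def length_Suc_conv)
    ultimately have "u # xs \<in> simple_paths V E k" "v \<in> V \<inter> ?N (u # xs)" "ys = v # u # xs"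
      by (auto simp: simple_paths_def)
    then show "ys \<in> (\<Union>xs\<in>simple_paths V E k. (\<lambda>v. v # xs) ` (V \<inter> ?N xs))" by blast
  qed
  then have "card (simple_paths V E (Suc k))
      \<le> card (\<Union>xs\<in>simple_paths V E k. (\<lambda>v. v # xs) ` (V \<inter> ?N xs))"
    using assms by (intro card_mono) (auto simp: finite_simple_paths)
  also have "\<dots> \<le> (\<Sum>xs\<in>simple_paths V E k. card ((\<lambda>v. v # xs) ` (V \<inter> ?N xs)))"
    using assms by (intro card_UN_le finite_simple_paths)
  also have "\<dots> \<le> (\<Sum>xs\<in>simple_paths V E k. max_degree V E)"
  proof (rule sum_mono)
    fix xs assume "xs \<in> simple_paths V E k"
    then have hd: "hd xs \<in> V" by (cases xs) (auto simp: simple_paths_def)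
    have "card ((\<lambda>v. v # xs) ` (V \<inter> ?N xs)) \<le> card (V \<inter> ?N xs)"
      using assms by (intro card_image_le) auto
    also have "\<dots> \<le> max_degree V E"
      using card_neighbours_le[OF assms hd] .
    finally show "card ((\<lambda>v. v # xs) ` (V \<inter> ?N xs)) \<le> max_degree V E" .
  qed
  also have "\<dots> \<le> card V * max_degree V E ^ k * max_degree V E"
    using Suc.IH by (simp add: mult_le_mono1)
  finally show ?case by (simp add: mult_ac)
qed

section \<open>Clusterings that respect the components\<close>

lemma length_leaf_list_pos: "0 < length (leaf_list T)"
  by (induction T) auto

lemma length_lca_subtree_le: "length (leaf_list (lca_subtree T S)) \<le> length (leaf_list T)"
  by (induction T) auto

lemma ex_hierarchical_clustering:
  assumes "finite V" "V \<noteq> {}"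
  shows "hierarchical_clusterings V \<noteq> {}"
  using assms
proof (induction V rule: finite_ne_induct)
  case (singleton v)
  have "HLeaf v \<in> hierarchical_clusterings {v}"
    by (simp add: hierarchical_clusterings_def)
  then show ?case by blast
next
  case (insert v V)
  then obtain T where "T \<in> hierarchical_clusterings V" by blast
  then have "HNode (HLeaf v) T \<in> hierarchical_clusterings (insert v V)"
    using insert by (simp add: hierarchical_clusterings_def)
  then show ?case by blast
qed

text \<open>Both children of a node have at least one leaf, hence each has fewer leaves than the
  node; this drives the induction on the number of leaves.\<close>

lemma finite_trees_bounded:
  assumes "finite V"
  shows "finite {T. length (leaf_list T) \<le> n \<and> set (leaf_list T) \<subseteq> V}"
proof (induction n)
  case 0
  have "{T. length (leaf_list T) \<le> 0 \<and> set (leaf_list T) \<subseteq> V} = {}"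
    using length_leaf_list_pos by auto
  then show ?case by simp
next
  case (Suc n)
  let ?F = "{T. length (leaf_list T) \<le> n \<and> set (leaf_list T) \<subseteq> V}"
  have "T \<in> HLeaf ` V \<union> case_prod HNode ` (?F \<times> ?F)"
    if "length (leaf_list T) \<le> Suc n" "set (leaf_list T) \<subseteq> V" for T
  proof (cases T)
    case (HNode l r)
    then have "(l, r) \<in> ?F \<times> ?F"
      using that length_leaf_list_pos[of l] length_leaf_list_pos[of r]
      by (simp del: length_greater_0_conv)
    then have "HNode l r \<in> case_prod HNode ` (?F \<times> ?F)" by force
    then show ?thesis unfolding HNode ..
  qed (use that in auto)
  then have "{T. length (leaf_list T) \<le> Suc n \<and> set (leaf_list T) \<subseteq> V}
      \<subseteq> HLeaf ` V \<union> case_prod HNode ` (?F \<times> ?F)" by blast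
  then show ?case using Suc assms by (meson finite_SigmaI finite_UnI finite_imageI finite_subset)
qed

lemma length_hierarchical_clustering:
  "T \<in> hierarchical_clusterings V \<Longrightarrow> length (leaf_list T) = card V"
  by (metis (mono_tags, lifting) distinct_card hierarchical_clusterings_def mem_Collect_eq)

lemma finite_hierarchical_clusterings:
  assumes "finite V"
  shows "finite (hierarchical_clusterings V)"
  by (rule finite_subset[OF _ finite_trees_bounded[OF assms, of "card V"]])
     (auto simp: hierarchical_clusterings_def distinct_card)

text \<open>Every block gets a tree of its own, and these trees are joined one at a time by a new
  root. A set inside a block then has its lowest common ancestor inside the tree of that
  block.\<close>

lemma ex_clustering_respecting_blocks:
  assumes "finite P" "P \<noteq> {}" "\<forall>C\<in>P. finite C \<and> C \<noteq> {}" "disjoint P"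
  shows "\<exists>T\<in>hierarchical_clusterings (\<Union>P). \<forall>C\<in>P. \<forall>S\<subseteq>C.
    S \<noteq> {} \<longrightarrow> length (leaf_list (lca_subtree T S)) \<le> card C"
  using assms
proof (induction P rule: finite_ne_induct)
  case (singleton C)
  then obtain T where T: "T \<in> hierarchical_clusterings C"
    using ex_hierarchical_clustering[of C] by blast
  have "length (leaf_list (lca_subtree T S)) \<le> card C" for S
    using length_lca_subtree_le[of T S] length_hierarchical_clustering[OF T] by simp
  then show ?case using T by auto
next
  case (insert C P)
  then obtain T' where T': "T' \<in> hierarchical_clusterings (\<Union>P)"
    and le: "\<And>D S. D \<in> P \<Longrightarrow> S \<subseteq> D \<Longrightarrow> S \<noteq> {} \<Longrightarrow> length (leaf_list (lca_subtree T' S)) \<le> card D"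
    by (auto simp: disjoint_def)
  obtain T where T: "T \<in> hierarchical_clusterings C"
    using ex_hierarchical_clustering[of C] insert by auto
  have lT: "length (leaf_list (lca_subtree T S)) \<le> card C" for S
    using length_lca_subtree_le[of T S] length_hierarchical_clustering[OF T] by simp
  have sT: "set (leaf_list T) = C" "set (leaf_list T') = \<Union>P"
    using T T' by (auto simp: hierarchical_clusterings_def)
  have disj: "C \<inter> D = {}" if "D \<in> P" for D
    using insert.prems(2) insert.hyps(3) that by (auto simp: disjoint_def)
  have "HNode T T' \<in> hierarchical_clusterings (\<Union>(insert C P))"
    using T T' disj by (fastforce simp: hierarchical_clusterings_def)
  moreover have "length (leaf_list (lca_subtree (HNode T T') S)) \<le> card D"
    if "D \<in> insert C P" "S \<subseteq> D" "S \<noteq> {}" for D S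
  proof (cases "D = C")
    case True
    then show ?thesis using that lT by (simp add: sT)
  next
    case False
    then have D: "D \<in> P" using that by simp
    \<comment> \<open>Being non-empty and disjoint from \<open>C\<close>, the set \<open>S\<close>
      makes \<open>lca_subtree\<close> descend into the right child \<open>T'\<close>.\<close>
    then have "\<not> S \<subseteq> C" "S \<subseteq> \<Union>P" using disj[of D] that by auto
    then show ?thesis using le[OF D] that by (simp add: sT)
  qed
  ultimately show ?case by blast
qed

text \<open>Follow a walk from \<open>z\<close> and put each new vertex in front. If the vertex is
  already on the path, cut the path back to the suffix that starts there.\<close>

lemma ex_simple_path:
  assumes "(z, u) \<in> {(a, b). {a, b} \<in> G}\<^sup>*"
  shows "\<exists>xs. xs \<noteq> [] \<and> distinct xs \<and> hd xs = u \<and> last xs = z \<and> path_edges xs \<subseteq> G"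
  using assms
proof (induction rule: rtrancl_induct)
  case base
  have "distinct [z] \<and> hd [z] = z \<and> last [z] = z \<and> path_edges [z] \<subseteq> G" by simp
  then show ?case by blast
next
  case (step u v)
  then obtain xs where xs: "xs \<noteq> []" "distinct xs" "hd xs = u" "last xs = z" "path_edges xs \<subseteq> G"
    by blast
  show ?case
  proof (cases "v \<in> set xs")
    case True
    then obtain ys zs where split: "xs = ys @ v # zs" by (auto dest: split_list)
    have "path_edges (v # zs) \<subseteq> G"
      using path_edges_append_subset[of "v # zs" ys] xs(5) split by auto
    moreover have "distinct (v # zs)" "last (v # zs) = z" using xs split by auto
    ultimately show ?thesis by (intro exI[of _ "v # zs"]) auto
  next
    case False
    then have "path_edges (v # xs) \<subseteq> G"
      using xs step.hyps(2) by (cases xs) (auto simp: insert_commute)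
    then show ?thesis using xs False by (intro exI[of _ "v # xs"]) auto
  qed
qed

text \<open>Start from a simple path between \<open>u\<close> and \<open>z\<close>. If it meets
  \<open>v\<close>, put \<open>u\<close> before the suffix starting at \<open>v\<close>; otherwise
  put \<open>v\<close> in front. The case decides the direction of the first edge, hence the
  conclusion \<open>{x, y} = {u, v}\<close>.\<close>

lemma ex_simple_path_through_edge:
  assumes "(z, u) \<in> {(a, b). {a, b} \<in> G}\<^sup>*" "{u, v} \<in> G" "u \<noteq> v"
  shows "\<exists>x y xs. distinct (x # y # xs) \<and> {x, y} = {u, v} \<and> last (y # xs) = z
    \<and> path_edges (x # y # xs) \<subseteq> G"
proof -
  obtain xs where xs: "xs \<noteq> []" "distinct xs" "hd xs = u" "last xs = z" "path_edges xs \<subseteq> G"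
    using ex_simple_path[OF assms(1)] by blast
  show ?thesis
  proof (cases "v \<in> set xs")
    case True
    then obtain ys zs where split: "xs = ys @ v # zs" by (auto dest: split_list)
    \<comment> \<open>As the head of \<open>xs\<close>, the vertex \<open>u\<close> precedes
      \<open>v\<close>, so distinctness keeps it off the suffix \<open>v # zs\<close>.\<close>
    have ys: "ys \<noteq> []" using split xs(3) assms(3) by auto
    then have "u \<in> set ys" using split xs(3) by (cases ys) auto
    have "path_edges (v # zs) \<subseteq> G"
      using path_edges_append_subset[of "v # zs" ys] xs(5) split by auto
    then have "path_edges (u # v # zs) \<subseteq> G" using assms by simp
    moreover have "distinct (u # v # zs)" "last (v # zs) = z"
      using xs split \<open>u \<in> set ys\<close> assms(3) by auto
    ultimately show ?thesis by blast
  next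
    case False
    obtain zs where zs: "xs = u # zs" using xs by (cases xs) auto
    have "path_edges (v # u # zs) \<subseteq> G"
      using xs zs assms(2) by (simp add: insert_commute)
    moreover have "distinct (v # u # zs)" "last (u # zs) = z" "{v, u} = {u, v}"
      using xs zs False by auto
    ultimately show ?thesis by blast
  qed
qed

lemma sum_component_sizes_le:
  assumes finV: "finite V" and finG: "finite G" and G: "\<forall>e\<in>G. e \<subseteq> V \<and> card e = 2"
  shows "(\<Sum>e\<in>G. card {z\<in>V. \<exists>u\<in>e. (z, u) \<in> {(a, b). {a, b} \<in> G}\<^sup>*})
    \<le> (\<Sum>k = 1..card V. card (simple_paths V G k))"
proof -
  let ?C = "\<lambda>e. {z\<in>V. \<exists>u\<in>e. (z, u) \<in> {(a, b). {a, b} \<in> G}\<^sup>*}"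
  \<comment> \<open>First edge and last vertex of a path. Since the image under \<open>?f\<close>
    covers all pairs of an edge and a vertex of its component, counting paths bounds the number of
    pairs.\<close>
  let ?f = "\<lambda>xs. ({hd xs, hd (tl xs)}, last xs)"
  let ?P = "\<Union>k\<in>{1..card V}. simple_paths V G k"
  have "Sigma G ?C \<subseteq> ?f ` ?P"
  proof
    fix p assume "p \<in> Sigma G ?C"
    then obtain e z u where p: "p = (e, z)" and e: "e \<in> G" "u \<in> e" and z: "z \<in> V"
      and zu: "(z, u) \<in> {(a, b). {a, b} \<in> G}\<^sup>*" by auto
    obtain v where v: "e = {u, v}" "u \<noteq> v"
      using G e by (metis card_2_iff doubleton_eq_iff insertE singletonD)
    obtain x y xs where xs: "distinct (x # y # xs)" "{x, y} = {u, v}" "last (y # xs) = z"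
      "path_edges (x # y # xs) \<subseteq> G"
      using ex_simple_path_through_edge[OF zu _ v(2)] e v(1) by blast
    have sub: "set (x # y # xs) \<subseteq> V"
    proof -
      have "set (x # y # xs) \<subseteq> \<Union>(path_edges (x # y # xs))"
        by (rule set_subset_Union_path_edges) simp
      also have "\<dots> \<subseteq> V" using xs(4) G by blast
      finally show ?thesis .
    qed
    \<comment> \<open>Distinct vertices in \<open>V\<close> bound the length, so the number of edges
      stays in the range of summation.\<close>
    have "length (x # y # xs) \<le> card V"
      using sub xs(1) finV by (metis card_mono distinct_card)
    then have "x # y # xs \<in> simple_paths V G (length (y # xs))" "length (y # xs) \<in> {1..card V}"
      using xs sub by (auto simp: simple_paths_def)
    then have "x # y # xs \<in> ?P" by blast
    moreover have "p = ?f (x # y # xs)" using p v(1) xs by simp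
    ultimately show "p \<in> ?f ` ?P" by blast
  qed
  moreover have finP: "finite ?P" using finV by (auto intro: finite_simple_paths)
  ultimately have "card (Sigma G ?C) \<le> card ?P"
    by (meson card_image_le card_mono finite_imageI order_trans)
  also have "\<dots> \<le> (\<Sum>k = 1..card V. card (simple_paths V G k))"
    by (rule card_UN_le) simp
  finally show ?thesis using finV finG by (simp add: card_SigmaI)
qed

section \<open>Weights that record only a set of edges, and their optimal cost\<close>

definition indicator_weight :: "'v set set \<Rightarrow> real \<Rightarrow> 'v set set \<Rightarrow> 'v set \<Rightarrow> real" where
  "indicator_weight E R G = (\<lambda>e\<in>E. if e \<in> G then R else 0)"

lemma indicator_weight_mem: "R \<ge> 0 \<Longrightarrow> indicator_weight E R G \<in> edge_weights E"
  by (auto simp: indicator_weight_def edge_weights_def)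

lemma hc_cost_indicator_weight:
  assumes "finite E" "G \<subseteq> E"
  shows "hc_cost E (indicator_weight E R G) T
    = R * (\<Sum>e\<in>G. real (length (leaf_list (lca_subtree T e))))"
proof -
  have "hc_cost E (indicator_weight E R G) T
      = (\<Sum>e\<in>E. if e \<in> G then R * real (length (leaf_list (lca_subtree T e))) else 0)"
    unfolding hc_cost_def indicator_weight_def by (intro sum.cong) auto
  also have "\<dots> = (\<Sum>e\<in>E \<inter> G. R * real (length (leaf_list (lca_subtree T e))))"
    using assms by (simp add: sum.inter_restrict)
  finally show ?thesis using assms by (simp add: sum_distrib_left Int_absorb1)
qed

lemma cut_weight_indicator_weight:
  assumes "finite E" "G \<subseteq> E"
  shows "cut_weight E (indicator_weight E R G) A B = R * real (card (cut_edges G A B))"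
proof -
  have "cut_weight E (indicator_weight E R G) A B = (\<Sum>e\<in>cut_edges E A B. if e \<in> G then R else 0)"
    unfolding cut_weight_def indicator_weight_def by (intro sum.cong) (auto simp: cut_edges_def)
  also have "\<dots> = (\<Sum>e\<in>cut_edges E A B \<inter> G. R)"
    using assms by (intro sum.inter_restrict[symmetric]) (auto simp: cut_edges_def)
  also have "cut_edges E A B \<inter> G = cut_edges G A B"
    using assms by (auto simp: cut_edges_def)
  finally show ?thesis by simp
qed

text \<open>In a tree that respects the components of \<open>G\<close>, an edge of \<open>G\<close>
  costs at most \<open>R\<close> times the size of its component, and edges outside \<open>G\<close>
  cost nothing.\<close>

lemma min_hc_cost_le:
  assumes finV: "finite V" "V \<noteq> {}" and finE: "finite E" and R: "R \<ge> 0"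
    and E: "\<forall>e\<in>E. e \<subseteq> V \<and> card e = 2" and G: "G \<subseteq> E"
  shows "Min (hc_cost E (indicator_weight E R G) ` hierarchical_clusterings V)
    \<le> R * (\<Sum>k = 1..card V. real (card (simple_paths V G k)))"
proof -
  \<comment> \<open>Reachability in \<open>G\<close>, restricted to \<open>V\<close> so that its
    classes partition \<open>V\<close>. Vertices on no edge of \<open>G\<close> form singleton
    classes.\<close>
  define r where "r = {(a, b). {a, b} \<in> G}\<^sup>* \<inter> V \<times> V"
  have finG: "finite G" using G finE by (rule finite_subset)
  have sym: "(y, x) \<in> {(a, b). {a, b} \<in> G}\<^sup>*" if "(x, y) \<in> {(a, b). {a, b} \<in> G}\<^sup>*" for x y
    using that by (rule symD[OF sym_rtrancl, rotated]) (auto simp: sym_def insert_commute)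
  then have eq: "equiv V r"
    unfolding r_def
    by (intro equivI) (auto simp: refl_on_def sym_def trans_def intro: sym rtrancl_trans)
  have "disjoint (V // r)" using quotient_disj[OF eq] by (auto simp: disjoint_def)
  moreover have "\<forall>C\<in>V // r. finite C \<and> C \<noteq> {}"
    using finV(1) in_quotient_imp_subset[OF eq] in_quotient_imp_non_empty[OF eq]
    by (meson finite_subset)
  moreover have "finite (V // r)" "V // r \<noteq> {}"
    using finV by (auto simp: r_def quotient_def)
  ultimately obtain T where T: "T \<in> hierarchical_clusterings V"
    and le: "\<And>C S. C \<in> V // r \<Longrightarrow> S \<subseteq> C \<Longrightarrow> S \<noteq> {} \<Longrightarrow>
      length (leaf_list (lca_subtree T S)) \<le> card C"
    using ex_clustering_respecting_blocks[of "V // r", unfolded Union_quotient[OF eq]]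
    by metis
  have "length (leaf_list (lca_subtree T e))
      \<le> card {z\<in>V. \<exists>u\<in>e. (z, u) \<in> {(a, b). {a, b} \<in> G}\<^sup>*}" if e: "e \<in> G" for e
  proof -
    obtain u v where uv: "e = {u, v}" "u \<in> V" "v \<in> V"
      using E G e by (metis card_2_iff insert_subset subsetD)
    have "e \<subseteq> r `` {u}" using uv e by (auto simp: r_def)
    then have "length (leaf_list (lca_subtree T e)) \<le> card (r `` {u})"
      using uv by (intro le quotientI) auto
    also have "\<dots> \<le> card {z\<in>V. \<exists>u\<in>e. (z, u) \<in> {(a, b). {a, b} \<in> G}\<^sup>*}"
      using finV uv eq by (intro card_mono) (auto simp: r_def dest: sym)
    finally show ?thesis .
  qed
  then have "(\<Sum>e\<in>G. length (leaf_list (lca_subtree T e)))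
      \<le> (\<Sum>e\<in>G. card {z\<in>V. \<exists>u\<in>e. (z, u) \<in> {(a, b). {a, b} \<in> G}\<^sup>*})"
    by (rule sum_mono)
  also have "\<dots> \<le> (\<Sum>k = 1..card V. card (simple_paths V G k))"
    using E G by (intro sum_component_sizes_le finV finG) auto
  finally have "real (\<Sum>e\<in>G. length (leaf_list (lca_subtree T e)))
      \<le> real (\<Sum>k = 1..card V. card (simple_paths V G k))"
    by (simp only: of_nat_le_iff)
  then have "hc_cost E (indicator_weight E R G) T
      \<le> R * (\<Sum>k = 1..card V. real (card (simple_paths V G k)))"
    using R by (simp add: hc_cost_indicator_weight[OF finE G] mult_left_mono)
  moreover have "Min (hc_cost E (indicator_weight E R G) ` hierarchical_clusterings V)
      \<le> hc_cost E (indicator_weight E R G) T"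
    using finite_hierarchical_clusterings[OF finV(1)] T by (intro Min_le) auto
  ultimately show ?thesis by linarith
qed

section \<open>The joint distribution of the sampled edges and the weights\<close>

lemma pmf_sample_edges:
  assumes "finite E" "0 < p" "p < 1" "S \<subseteq> E"
  shows "pmf (sample_edges E p) S = p ^ card S * (1 - p) ^ (card E - card S)"
proof -
  let ?M = "Pi_pmf E False (\<lambda>_. bernoulli_pmf p)"
  have supp: "set_pmf ?M = PiE_dflt E False (\<lambda>_. UNIV)"
    using assms by (simp add: set_Pi_pmf o_def set_pmf_bernoulli)
  \<comment> \<open>Functions in the support take the default \<open>False\<close> outside
    \<open>E\<close>, so the selected subset determines them.\<close>
  have "inj_on (\<lambda>b. {e\<in>E. b e}) (set_pmf ?M)"
    unfolding supp by (rule inj_onI, rule ext) (auto simp: PiE_dflt_def)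
  moreover have "(\<lambda>e. e \<in> S) \<in> set_pmf ?M"
    unfolding supp using assms by (auto simp: PiE_dflt_def)
  ultimately have "pmf (sample_edges E p) {e\<in>E. e \<in> S} = pmf ?M (\<lambda>e. e \<in> S)"
    unfolding sample_edges_def by (rule pmf_map_inj)
  also have "\<dots> = (\<Prod>e\<in>E. if e \<in> S then p else 1 - p)"
    using assms by (subst pmf_Pi') (auto intro!: prod.cong)
  also have "\<dots> = (\<Prod>e\<in>E \<inter> S. p) * (\<Prod>e\<in>E \<inter> - S. 1 - p)"
    using assms prod.If_cases[of E "\<lambda>e. e \<in> S" "\<lambda>_. p" "\<lambda>_. 1 - p"] by simp
  finally have "pmf (sample_edges E p) {e\<in>E. e \<in> S} = (\<Prod>e\<in>E \<inter> S. p) * (\<Prod>e\<in>E \<inter> - S. 1 - p)" .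
  moreover have "E \<inter> S = S" "E \<inter> - S = E - S" "{e\<in>E. e \<in> S} = S" using assms(4) by auto
  ultimately show ?thesis using assms by (simp add: card_Diff_subset finite_subset)
qed

lemma set_pmf_sample_edges: "set_pmf (sample_edges E p) \<subseteq> Pow E"
  by (auto simp: sample_edges_def)

section \<open>Uniform bit strings as uniform subsets of the sampled edges\<close>

lemma finite_bit_strings [simp]: "finite (bit_strings m)"
  by (auto simp: bit_strings_def intro: finite_PiE)

lemma card_bit_strings: "card (bit_strings m) = 2 ^ m"
  by (simp add: bit_strings_def card_PiE numeral_2_eq_2)

lemma bit_strings_nonempty: "bit_strings m \<noteq> {}"
  using card_bit_strings[of m] by force

text \<open>The set \<open>G\<close> fixes the bits at positions \<open>1..card E'\<close>, because
  \<open>l\<close> hits each of them once; the remaining \<open>m - card E'\<close> bits are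
  free.\<close>

lemma card_bit_strings_prescribed:
  assumes "finite E'" "card E' \<le> m" "bij_betw l E' {1..card E'}" "G \<subseteq> E'"
  shows "card {x \<in> bit_strings m. {e\<in>E'. x (l e) = 1} = G} = 2 ^ (m - card E')"
proof -
  let ?k = "card E'"
  let ?B = "\<lambda>i. if i \<le> ?k then {if i \<in> l ` G then 1 else 0} else {0, 1 :: nat}"
  have inj: "inj_on l E'" and im: "l ` E' = {1..?k}"
    using assms(3) by (auto simp: bij_betw_def)
  have l_mem: "l e \<in> l ` G \<longleftrightarrow> e \<in> G" if "e \<in> E'" for e
    using inj that assms(4) by (rule inj_on_image_mem_iff)
  have l_dom: "l e \<in> {1..m}" "l e \<le> ?k" if "e \<in> E'" for e
    using im that assms(2) by (auto simp: set_eq_iff image_iff) (metis atLeastAtMost_iff order_trans)+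
  have "{x \<in> bit_strings m. {e\<in>E'. x (l e) = 1} = G} = PiE {1..m} ?B"
  proof (intro equalityI subsetI)
    fix x assume x: "x \<in> {x \<in> bit_strings m. {e\<in>E'. x (l e) = 1} = G}"
    then have bits: "x i \<in> {0, 1}" if "i \<in> {1..m}" for i
      using that unfolding bit_strings_def by blast
    have "x i \<in> ?B i" if i: "i \<in> {1..m}" for i
    proof (cases "i \<le> ?k")
      case True
      then have "i \<in> l ` E'" using i by (simp add: im)
      then obtain e where e: "e \<in> E'" "i = l e" by blast
      have "i \<in> l ` G \<longleftrightarrow> x i = 1" using x e l_mem[OF e(1)] by blast
      then show ?thesis using True bits[OF i] by auto
    next
      case False
      then show ?thesis using bits[OF i] by simp
    qed
    then show "x \<in> PiE {1..m} ?B" using x by (auto simp: bit_strings_def PiE_iff)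
  next
    fix x assume x: "x \<in> PiE {1..m} ?B"
    have val: "x i \<in> ?B i" if "i \<in> {1..m}" for i
      using x that by (rule PiE_mem)
    have "x (l e) = 1 \<longleftrightarrow> e \<in> G" if "e \<in> E'" for e
      using val[OF l_dom(1)[OF that]] l_dom(2)[OF that] l_mem[OF that] by (auto split: if_splits)
    then have "{e\<in>E'. x (l e) = 1} = G" using assms(4) by blast
    moreover have "x \<in> bit_strings m"
    proof -
      have "x i \<in> {0, 1}" if "i \<in> {1..m}" for i
        using val[OF that] by (simp split: if_splits)
      then show ?thesis using x unfolding bit_strings_def PiE_iff by blast
    qed
    ultimately show "x \<in> {x \<in> bit_strings m. {e\<in>E'. x (l e) = 1} = G}" by simp
  qed
  then have "card {x \<in> bit_strings m. {e\<in>E'. x (l e) = 1} = G} = (\<Prod>i\<in>{1..m}. card (?B i))"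
    by (simp add: card_PiE)
  also have "\<dots> = (\<Prod>i\<in>{1..m}. if i \<in> {Suc ?k..m} then 2 else 1)"
    by (intro prod.cong) auto
  also have "\<dots> = (\<Prod>i\<in>{1..m} \<inter> {Suc ?k..m}. 2)"
    by (intro prod.inter_restrict[symmetric]) simp
  also have "{1..m} \<inter> {Suc ?k..m} = {Suc ?k..m}" by auto
  finally show ?thesis by simp
qed

text \<open>Each \<open>G \<subseteq> E'\<close> arises from equally many bit strings, so a uniform
  string selects a uniform subset of \<open>E'\<close>.\<close>

lemma sum_bit_strings:
  fixes f :: "'a set \<Rightarrow> real"
  assumes "finite E'" "card E' \<le> m" "bij_betw l E' {1..card E'}"
  shows "(\<Sum>x\<in>bit_strings m. f {e\<in>E'. x (l e) = 1}) / 2 ^ m = (\<Sum>G\<in>Pow E'. f G) / 2 ^ card E'"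
proof -
  let ?g = "\<lambda>x. {e\<in>E'. x (l e) = 1}"
  have "(\<Sum>x\<in>bit_strings m. f (?g x))
      = (\<Sum>G\<in>Pow E'. \<Sum>x\<in>{x\<in>bit_strings m. ?g x = G}. f (?g x))"
    using assms by (intro sum.group[symmetric]) auto
  also have "\<dots> = (\<Sum>G\<in>Pow E'. 2 ^ (m - card E') * f G)"
    using card_bit_strings_prescribed[OF assms] by (intro sum.cong) auto
  finally show ?thesis
    using assms(2) by (simp add: sum_divide_distrib power_diff mult.commute)
qed

text \<open>Puts \<open>G\<close>, on which the distribution of the tree depends, outside, and
  leaves \<open>E'\<close> as the remaining randomness.\<close>

lemma sum_Pow_Pow_swap:
  assumes "finite E"
  shows "(\<Sum>E'\<in>Pow E. \<Sum>G\<in>Pow E'. f E' G) = (\<Sum>G\<in>Pow E. \<Sum>E' | G \<subseteq> E' \<and> E' \<subseteq> E. f E' G)"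
proof -
  have "(\<Sum>E'\<in>Pow E. \<Sum>G\<in>Pow E'. f E' G) = (\<Sum>(E', G)\<in>Sigma (Pow E) Pow. f E' G)"
    using assms by (intro sum.Sigma) (auto intro: finite_subset)
  also have "\<dots> = (\<Sum>(G, E')\<in>Sigma (Pow E) (\<lambda>G. {E'. G \<subseteq> E' \<and> E' \<subseteq> E}). f E' G)"
    by (rule sum.reindex_bij_witness[where i = prod.swap and j = prod.swap]) auto
  also have "\<dots> = (\<Sum>G\<in>Pow E. \<Sum>E' | G \<subseteq> E' \<and> E' \<subseteq> E. f E' G)"
    using assms by (intro sum.Sigma[symmetric]) auto
  finally show ?thesis .
qed

section \<open>The law of \<open>G\<close>: each edge of \<open>E\<close> kept independently with
  probability \<open>q\<close>\<close>

definition subset_prob :: "real \<Rightarrow> 'a set \<Rightarrow> 'a set \<Rightarrow> real" where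
  "subset_prob q E G = q ^ card G * (1 - q) ^ (card E - card G)"

lemma subset_prob_nonneg: "0 \<le> q \<Longrightarrow> q \<le> 1 \<Longrightarrow> 0 \<le> subset_prob q E G"
  by (simp add: subset_prob_def)

lemma sum_subset_prob_supersets:
  assumes "finite E" "S \<subseteq> E"
  shows "(\<Sum>G | S \<subseteq> G \<and> G \<subseteq> E. subset_prob q E G) = q ^ card S"
  unfolding subset_prob_def using assms by (simp add: sum_supersets_power_card)

lemma sum_subset_prob: "finite E \<Longrightarrow> (\<Sum>G\<in>Pow E. subset_prob q E G) = 1"
  using sum_subset_prob_supersets[of E "{}" q] by (simp add: Pow_def)

text \<open>Linearity of expectation: each path of \<open>E\<close> has \<open>k\<close> different
  edges, all of which lie in \<open>G\<close> with probability \<open>q ^ k\<close>.\<close>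

lemma expected_card_simple_paths:
  assumes "finite V" "finite E"
  shows "(\<Sum>G\<in>Pow E. subset_prob q E G * real (card (simple_paths V G k)))
    = real (card (simple_paths V E k)) * q ^ k"
proof -
  have fin: "finite (simple_paths V E k)" by (rule finite_simple_paths[OF assms(1)])
  have card: "real (card (simple_paths V G k))
      = (\<Sum>xs\<in>simple_paths V E k. if path_edges xs \<subseteq> G then 1 else 0)" if "G \<subseteq> E" for G
  proof -
    have "simple_paths V G k = {xs\<in>simple_paths V E k. path_edges xs \<subseteq> G}"
      using that by (auto simp: simple_paths_def)
    then show ?thesis using fin by (simp flip: sum.inter_filter)
  qed
  have "(\<Sum>G\<in>Pow E. subset_prob q E G * real (card (simple_paths V G k)))
      = (\<Sum>G\<in>Pow E. \<Sum>xs\<in>simple_paths V E k. if path_edges xs \<subseteq> G then subset_prob q E G else 0)"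
    by (intro sum.cong) (auto simp: card sum_distrib_left intro!: sum.cong)
  also have "\<dots> = (\<Sum>xs\<in>simple_paths V E k. \<Sum>G\<in>Pow E. if path_edges xs \<subseteq> G then subset_prob q E G else 0)"
    by (rule sum.swap)
  also have "\<dots> = (\<Sum>xs\<in>simple_paths V E k. q ^ k)"
  proof (rule sum.cong)
    fix xs assume xs: "xs \<in> simple_paths V E k"
    have "(\<Sum>G\<in>Pow E. if path_edges xs \<subseteq> G then subset_prob q E G else 0)
        = (\<Sum>G\<in>{G\<in>Pow E. path_edges xs \<subseteq> G}. subset_prob q E G)"
      using assms by (simp flip: sum.inter_filter)
    also have "{G\<in>Pow E. path_edges xs \<subseteq> G} = {G. path_edges xs \<subseteq> G \<and> G \<subseteq> E}" by auto
    also have "sum (subset_prob q E) \<dots> = q ^ card (path_edges xs)"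
      using assms xs by (intro sum_subset_prob_supersets) (auto simp: simple_paths_def)
    also have "card (path_edges xs) = k"
      using xs by (simp add: simple_paths_def card_path_edges)
    finally show "(\<Sum>G\<in>Pow E. if path_edges xs \<subseteq> G then subset_prob q E G else 0) = q ^ k" .
  qed simp
  finally show ?thesis by simp
qed

text \<open>The labels of sampled edges are positions of \<open>x\<close>, so the bits read are 0 or
  1 and the weights are 0 or \<open>R\<close>. This is why the algorithm learns \<open>G\<close>
  alone.\<close>

lemma attack_weights_eq_indicator_weight:
  assumes "x \<in> bit_strings m" "E' \<subseteq> E" "card E' \<le> m" "bij_betw l E' {1..card E'}"
  shows "attack_weights E R x E' l = indicator_weight E R {e\<in>E'. x (l e) = 1}"
proof -
  have "x (l e) \<in> {0, 1}" if "e \<in> E'" for e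
  proof -
    have "l e \<in> {1..card E'}" using assms(4) that by (auto simp: bij_betw_def)
    then show ?thesis using assms(1,3) by (auto simp: bit_strings_def PiE_iff)
  qed
  then show ?thesis
    unfolding attack_weights_def indicator_weight_def by (fastforce simp: restrict_def fun_eq_iff)
qed

text \<open>Sampling each edge with probability \<open>p\<close> and then choosing \<open>G \<subseteq> E'\<close> uniformly gives the pair
  \<open>(G, E')\<close> the weight \<open>(p / 2) ^ card E' * (1 - p) ^ (card E - card E')\<close>.\<close>

lemma expectation_Rec_HC:
  fixes V :: "'v set" and E :: "'v set set" and H :: "'v hc_tree \<Rightarrow> 'v set \<times> 'v set"
  defines "p \<equiv> 0.5 / real (max_degree V E)"
  assumes fin: "finite V" "finite E" and p: "0 < p" "p < 1" and R: "0 \<le> R"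
    and alg: "is_hc_algorithm_on V E \<A>" and lab: "is_labelling E lab"
    and h: "\<And>x E' T. x \<in> bit_strings (card E) \<Longrightarrow> E' \<subseteq> E \<Longrightarrow>
      h (x, lab E' ` cut_edges E' (fst (H T)) (snd (H T)), \<lambda>_. 0)
        = g E' {e\<in>E'. x (lab E' e) = 1} T"
  shows "measure_pmf.expectation (attack_experiment (card E) (Rec_HC V E R \<A> H lab)) h
    = (\<Sum>G\<in>Pow E. \<Sum>E' | G \<subseteq> E' \<and> E' \<subseteq> E. (p / 2) ^ card E' * (1 - p) ^ (card E - card E')
        * measure_pmf.expectation (\<A> V E (indicator_weight E R G)) (g E' G))"
proof -
  let ?m = "card E"
  let ?B = "bit_strings ?m"
  let ?G = "\<lambda>x E'. {e\<in>E'. x (lab E' e) = 1}"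
  let ?Ex = "\<lambda>G E'. measure_pmf.expectation (\<A> V E (indicator_weight E R G)) (g E' G)"
  \<comment> \<open>The output ranges over finitely many clusterings, so the expectations below can
    be expanded into finite sums.\<close>
  have finA: "finite (set_pmf (\<A> V E (indicator_weight E R G)))" for G
    using alg indicator_weight_mem[OF R] finite_hierarchical_clusterings[OF fin(1)]
    by (auto simp: is_hc_algorithm_on_def intro: finite_subset)
  have bij: "bij_betw (lab E') E' {1..card E'}" "card E' \<le> ?m" "finite E'" if "E' \<subseteq> E" for E'
    using lab fin that by (auto simp: is_labelling_def card_mono finite_subset)
  have w: "attack_weights E R x E' (lab E') = indicator_weight E R (?G x E')"
    if "x \<in> ?B" "E' \<subseteq> E" for x E'
    using that bij by (intro attack_weights_eq_indicator_weight) auto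
  \<comment> \<open>The rest of the experiment once \<open>x\<close> and \<open>E'\<close> have been
    drawn.\<close>
  define cont where "cont x E' = \<A> V E (attack_weights E R x E' (lab E')) \<bind>
     (\<lambda>T. return_pmf (x, lab E' ` cut_edges E' (fst (H T)) (snd (H T)), \<lambda>_ :: nat. 0 :: nat))" for x E'
  have exp: "attack_experiment ?m (Rec_HC V E R \<A> H lab)
      = pmf_of_set ?B \<bind> (\<lambda>x. sample_edges E p \<bind> cont x)"
    unfolding attack_experiment_def Rec_HC_def cont_def p_def
    by (simp add: bind_assoc_pmf bind_return_pmf split_beta Let_def)
  have cont_fin: "finite (set_pmf (cont x E'))" if "x \<in> ?B" "E' \<subseteq> E" for x E'
    using finA by (simp add: cont_def w[OF that])
  have cont: "measure_pmf.expectation (cont x E') h = ?Ex (?G x E') E'"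
    if "x \<in> ?B" "E' \<subseteq> E" for x E'
  proof -
    have "cont x E' = map_pmf (\<lambda>T. (x, lab E' ` cut_edges E' (fst (H T)) (snd (H T)), \<lambda>_. 0))
        (\<A> V E (indicator_weight E R (?G x E')))"
      by (simp add: cont_def map_pmf_def w[OF that])
    then show ?thesis by (simp add: h[OF that])
  qed
  have inner: "measure_pmf.expectation (sample_edges E p \<bind> cont x) h
      = (\<Sum>E'\<in>Pow E. p ^ card E' * (1 - p) ^ (?m - card E') * ?Ex (?G x E') E')" if "x \<in> ?B" for x
    using fin p that cont_fin
    by (subst pmf_expectation_bind[where A = "Pow E"])
       (auto simp: set_pmf_sample_edges[THEN subsetD] pmf_sample_edges cont dest!: set_pmf_sample_edges[THEN subsetD] intro!: sum.cong)
  have "finite (set_pmf (sample_edges E p))"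
    by (rule finite_subset[OF set_pmf_sample_edges]) (simp add: fin)
  then have "finite (set_pmf (sample_edges E p \<bind> cont x))" if "x \<in> ?B" for x
    unfolding set_bind_pmf using cont_fin[OF that] set_pmf_sample_edges[of E p]
    by (meson PowD finite_UN_I subsetD)
  then have "measure_pmf.expectation (attack_experiment ?m (Rec_HC V E R \<A> H lab)) h
      = (\<Sum>x\<in>?B. (\<Sum>E'\<in>Pow E. p ^ card E' * (1 - p) ^ (?m - card E') * ?Ex (?G x E') E') / 2 ^ ?m)"
    unfolding exp using bit_strings_nonempty
    by (subst pmf_expectation_bind_pmf_of_set)
       (auto simp: inner card_bit_strings divide_inverse mult.commute intro!: sum.cong)
  also have "\<dots> = (\<Sum>E'\<in>Pow E. p ^ card E' * (1 - p) ^ (?m - card E')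
      * ((\<Sum>x\<in>?B. ?Ex (?G x E') E') / 2 ^ ?m))"
    by (simp add: sum_divide_distrib sum_distrib_left) (rule sum.swap)
  \<comment> \<open>For fixed \<open>E'\<close> the average over \<open>x\<close> becomes the
    average over \<open>G \<subseteq> E'\<close>; its factor \<open>1 / 2 ^ card E'\<close> then
    turns \<open>p\<close> into \<open>p / 2\<close>.\<close>
  also have "\<dots> = (\<Sum>E'\<in>Pow E. p ^ card E' * (1 - p) ^ (?m - card E')
      * ((\<Sum>G\<in>Pow E'. ?Ex G E') / 2 ^ card E'))"
  proof (intro sum.cong refl arg_cong2[where f = "(*)"])
    fix E' assume "E' \<in> Pow E"
    then show "(\<Sum>x\<in>?B. ?Ex (?G x E') E') / 2 ^ ?m = (\<Sum>G\<in>Pow E'. ?Ex G E') / 2 ^ card E'"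
      using bij[of E'] by (intro sum_bit_strings[where f = "\<lambda>G. ?Ex G E'"]) auto
  qed
  also have "\<dots> = (\<Sum>E'\<in>Pow E. \<Sum>G\<in>Pow E'. (p / 2) ^ card E' * (1 - p) ^ (?m - card E') * ?Ex G E')"
    by (intro sum.cong refl) (simp add: power_divide sum_distrib_left sum_divide_distrib)
  also have "\<dots> = (\<Sum>G\<in>Pow E. \<Sum>E' | G \<subseteq> E' \<and> E' \<subseteq> E.
      (p / 2) ^ card E' * (1 - p) ^ (card E - card E') * ?Ex G E')"
    by (rule sum_Pow_Pow_swap[OF fin(2)])
  finally show ?thesis .
qed

section \<open>Expected size and expected errors\<close>

lemma min_balanced_cut_le:
  assumes "finite V" "finite E" "balanced_cut V A B"
  shows "min_balanced_cut V E \<le> card (cut_edges E A B)"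
proof -
  have "{card (cut_edges E A B) | A B. balanced_cut V A B}
      \<subseteq> (\<lambda>(A, B). card (cut_edges E A B)) ` (Pow V \<times> Pow V)"
    by (auto simp: balanced_cut_def image_iff)
  then have "finite {card (cut_edges E A B) | A B. balanced_cut V A B}"
    by (rule finite_subset) (simp add: assms(1))
  then show ?thesis
    unfolding min_balanced_cut_def using assms(3) by (intro Min_le) auto
qed

text \<open>Positivity, from the lower bound \<open>n / 3\<close> on both sides, allows the
  denominator in \<open>is_HCToBC\<close> to be cleared; the upper bound is the inequality of
  arithmetic and geometric means.\<close>

lemma balanced_cut_card:
  assumes "finite V" "V \<noteq> {}" "balanced_cut V A B"
  shows "0 < real (card A) * real (card B)" "real (card A) * real (card B) \<le> (real (card V))\<^sup>2 / 4"
proof -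
  have "0 < real (card V)" using assms by (simp add: card_gt_0_iff)
  then have "0 < real (card A)" "0 < real (card B)"
    using assms(3) by (auto simp: balanced_cut_def)
  then show "0 < real (card A) * real (card B)" by simp
  have "finite A" "finite B" using assms by (auto simp: balanced_cut_def)
  then have "real (card V) = real (card A) + real (card B)"
    using assms(3) by (auto simp: balanced_cut_def card_Un_disjoint)
  moreover have "0 \<le> (real (card A) - real (card B))\<^sup>2" by simp
  ultimately show "real (card A) * real (card B) \<le> (real (card V))\<^sup>2 / 4"
    by (simp add: power2_eq_square algebra_simps)
qed

text \<open>Multiply the \<open>HCToBC\<close> inequality by \<open>card A * card B\<close>, which
  is at most a quarter of the squared number of vertices; this turns the constant 4 into 16 and
  leaves one power in the denominator.\<close>

lemma card_cut_edges_le_hc_cost: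
  assumes "finite V" "V \<noteq> {}" "finite E" "G \<subseteq> E" "R > 0" "is_HCToBC V E H"
    and T: "T \<in> hierarchical_clusterings V"
  shows "R * real (card (cut_edges G (fst (H T)) (snd (H T))))
    \<le> 27 / (16 * real (card V)) * hc_cost E (indicator_weight E R G) T"
proof -
  let ?n = "real (card V)" and ?A = "fst (H T)" and ?B = "snd (H T)"
  let ?c = "hc_cost E (indicator_weight E R G) T"
  have n: "?n > 0" using assms by (simp add: card_gt_0_iff)
  have w: "indicator_weight E R G \<in> edge_weights E"
    using assms by (intro indicator_weight_mem) simp
  have bal: "balanced_cut V ?A ?B"
    using assms(6) T unfolding is_HCToBC_def by (metis prod.collapse)
  have "cut_weight E (indicator_weight E R G) ?A ?B / (real (card ?A) * real (card ?B))
      \<le> 27 / (4 * ?n ^ 3) * ?c"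
    using assms(6) T w unfolding is_HCToBC_def by (metis prod.collapse)
  then have "cut_weight E (indicator_weight E R G) ?A ?B
      \<le> (27 / (4 * ?n ^ 3) * ?c) * (real (card ?A) * real (card ?B))"
    using balanced_cut_card(1)[OF assms(1,2) bal] by (simp only: pos_divide_le_eq)
  also have "\<dots> \<le> (27 / (4 * ?n ^ 3) * ?c) * (?n\<^sup>2 / 4)"
  proof (intro mult_left_mono mult_nonneg_nonneg)
    show "0 \<le> ?c"
      using assms by (simp add: hc_cost_indicator_weight sum_nonneg)
  qed (use balanced_cut_card(2)[OF assms(1,2) bal] n in auto)
  also have "\<dots> = 27 / (16 * ?n) * ?c"
    using n by (simp add: field_simps power2_eq_square power3_eq_cube)
  finally show ?thesis using assms by (simp add: cut_weight_indicator_weight)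
qed

lemma sum_power_quarter_le: "(\<Sum>k = 1..n. (1 / 4 :: real) ^ k) \<le> 1 / 3"
proof -
  have "(\<Sum>k = 1..n. (1 / 4 :: real) ^ k) = (1 - (1 / 4) ^ n) / 3"
    by (induction n) simp_all
  also have "\<dots> \<le> 1 / 3" by simp
  finally show ?thesis .
qed

lemma expected_min_hc_cost_le:
  fixes V :: "'v set" and E :: "'v set set"
  defines "q \<equiv> 1 / (4 * real (max_degree V E))"
  assumes "finite V" "V \<noteq> {}" "finite E" "R \<ge> 0" "\<forall>e\<in>E. e \<subseteq> V \<and> card e = 2"
    and d: "max_degree V E \<ge> 1"
  shows "(\<Sum>G\<in>Pow E. subset_prob q E G
      * Min (hc_cost E (indicator_weight E R G) ` hierarchical_clusterings V))
    \<le> R * real (card V) / 3"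
proof -
  have q: "0 \<le> q" "q \<le> 1" using d by (auto simp: q_def field_simps)
  have "(\<Sum>G\<in>Pow E. subset_prob q E G
      * Min (hc_cost E (indicator_weight E R G) ` hierarchical_clusterings V))
    \<le> (\<Sum>G\<in>Pow E. subset_prob q E G * (R * (\<Sum>k = 1..card V. real (card (simple_paths V G k)))))"
    using assms q by (intro sum_mono mult_left_mono min_hc_cost_le subset_prob_nonneg) auto
  also have "\<dots> = R * (\<Sum>G\<in>Pow E. \<Sum>k = 1..card V. subset_prob q E G * real (card (simple_paths V G k)))"
    by (simp add: sum_distrib_left mult_ac)
  also have "\<dots> = R * (\<Sum>k = 1..card V. \<Sum>G\<in>Pow E. subset_prob q E G * real (card (simple_paths V G k)))"
    by (subst sum.swap) simp
  also have "\<dots> = R * (\<Sum>k = 1..card V. real (card (simple_paths V E k)) * q ^ k)"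
    using assms by (simp add: expected_card_simple_paths)
  also have "\<dots> \<le> R * (\<Sum>k = 1..card V. real (card V) * (1 / 4) ^ k)"
  proof (intro mult_left_mono sum_mono)
    fix k
    have "real (card (simple_paths V E k)) * q ^ k
        \<le> real (card V * max_degree V E ^ k) * q ^ k"
      using card_simple_paths_le[of V E k] assms q by (intro mult_right_mono) (auto simp flip: of_nat_mult of_nat_power)
    also have "\<dots> = real (card V) * (real (max_degree V E) * q) ^ k"
      by (simp add: power_mult_distrib)
    \<comment> \<open>The sampling rate is tuned to the degree: each further edge multiplies the
      number of paths by at most the degree but their probability by \<open>q\<close>.\<close>
    also have "real (max_degree V E) * q = 1 / 4" using d by (simp add: q_def)
    finally show "real (card (simple_paths V E k)) * q ^ k \<le> real (card V) * (1 / 4) ^ k" .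
  qed fact
  also have "\<dots> = R * (real (card V) * (\<Sum>k = 1..card V. (1 / 4) ^ k))"
    by (simp add: sum_distrib_left)
  also have "\<dots> \<le> R * (real (card V) * (1 / 3))"
    using assms by (intro mult_left_mono sum_power_quarter_le) auto
  finally show ?thesis by simp
qed

text \<open>For a cut that depends only on \<open>G\<close>: given \<open>G\<close>, an edge of
  \<open>G\<close> surely lies in \<open>E'\<close>, and any other edge does with probability
  \<open>(p / 2) / (1 - p / 2) \<ge> p / 2\<close>. Summing over the edges of the cut gives the
  bound.\<close>

lemma expected_new_cut_edges_ge:
  fixes E :: "'v set set" and p :: real
  assumes fin: "finite E" and G: "G \<subseteq> E" and p: "0 \<le> p" "p \<le> 1"
  shows "p / 2 * subset_prob (p / 2) E G * real (card (cut_edges E A B))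
    \<le> (\<Sum>E' | G \<subseteq> E' \<and> E' \<subseteq> E. (p / 2) ^ card E' * (1 - p) ^ (card E - card E')
        * real (card (cut_edges E' A B)))"
proof -
  define c where "c E' = (p / 2) ^ card E' * (1 - p) ^ (card E - card E')" for E' :: "'v set set"
  let ?S = "{E'. G \<subseteq> E' \<and> E' \<subseteq> E}"
  have finS: "finite ?S" using fin by simp
  have "finite G" using fin G by (rule rev_finite_subset)
  have "p / 2 * subset_prob (p / 2) E G \<le> (\<Sum>E'\<in>{E'\<in>?S. e \<in> E'}. c E')"
    if e: "e \<in> cut_edges E A B" for e
  proof -
    have "e \<in> E" using e by (simp add: cut_edges_def)
    have "{E'\<in>?S. e \<in> E'} = {E'. insert e G \<subseteq> E' \<and> E' \<subseteq> E}" by auto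
    then have sum: "(\<Sum>E'\<in>{E'\<in>?S. e \<in> E'}. c E')
        = (p / 2) ^ card (insert e G) * (1 - p / 2) ^ (card E - card (insert e G))"
      unfolding c_def using sum_supersets_power_card[of E "insert e G" "p / 2" "1 - p"] G \<open>e \<in> E\<close> fin
      by simp
    show ?thesis
    proof (cases "e \<in> G")
      case True
      have "p / 2 * subset_prob (p / 2) E G \<le> 1 * subset_prob (p / 2) E G"
        using p by (intro mult_right_mono subset_prob_nonneg) auto
      then show ?thesis using True unfolding sum by (simp add: subset_prob_def insert_absorb)
    next
      case False
      have "p / 2 * subset_prob (p / 2) E G
          = (p / 2) ^ card (insert e G) * (1 - p / 2) ^ (card E - card G)"
        using False \<open>finite G\<close> by (simp add: subset_prob_def)
      \<comment> \<open>Only one factor \<open>1 - p / 2\<close>, which is at most 1, is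
        dropped.\<close>
      also have "\<dots> \<le> (p / 2) ^ card (insert e G) * (1 - p / 2) ^ (card E - card (insert e G))"
        using p False \<open>finite G\<close>
        by (intro mult_left_mono power_decreasing) auto
      finally show ?thesis unfolding sum .
    qed
  qed
  then have "(\<Sum>e\<in>cut_edges E A B. p / 2 * subset_prob (p / 2) E G)
      \<le> (\<Sum>e\<in>cut_edges E A B. \<Sum>E'\<in>{E'\<in>?S. e \<in> E'}. c E')"
    by (rule sum_mono)
  also have "\<dots> = (\<Sum>e\<in>cut_edges E A B. \<Sum>E'\<in>?S. if e \<in> E' then c E' else 0)"
    using finS by (simp only: sum.inter_filter)
  also have "\<dots> = (\<Sum>E'\<in>?S. \<Sum>e\<in>cut_edges E A B. if e \<in> E' then c E' else 0)"
    by (rule sum.swap)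
  also have "\<dots> = (\<Sum>E'\<in>?S. c E' * real (card (cut_edges E' A B)))"
  proof (rule sum.cong)
    fix E' assume "E' \<in> ?S"
    then have "{e\<in>cut_edges E A B. e \<in> E'} = cut_edges E' A B" by (auto simp: cut_edges_def)
    moreover have "finite (cut_edges E A B)" using fin by (simp add: cut_edges_def)
    ultimately show "(\<Sum>e\<in>cut_edges E A B. if e \<in> E' then c E' else 0)
        = c E' * real (card (cut_edges E' A B))"
      by (simp flip: sum.inter_filter)
  qed simp
  finally show ?thesis by (simp add: c_def mult_ac)
qed

theorem theorem5p2:
  fixes V :: "'v set" and E :: "'v set set" and R :: real
    and \<A> :: "'v hc_algorithm"
    and H :: "'v hc_tree \<Rightarrow> 'v set \<times> 'v set"
    and lab :: "'v set set \<Rightarrow> 'v set \<Rightarrow> nat"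
  assumes "connected_simple_graph V E"
    and "card E > card V"
    and "max_degree V E \<ge> 8"
    and "real (min_balanced_cut V E)
           \<ge> max (8 * real (card V)) (10000 * real (max_degree V E) * log 2 (real (card V)))"
    and "R > 0"
    and "is_hc_algorithm_on V E \<A>"
    and "expected_additive_error_le V E \<A>
           (R * (real (card V) * real (min_balanced_cut V E) / (400 * real (max_degree V E))))"
    and "is_HCToBC V E H"
    and "is_labelling E lab"
  shows "Succ_attack (card E) (Rec_HC V E R \<A> H lab) \<ge> 0.4
    \<and> expected_size (card E) (Rec_HC V E R \<A> H lab)
        \<ge> real (min_balanced_cut V E) / (8 * real (max_degree V E))"
proof -
  define d where "d = real (max_degree V E)"
  define n where "n = real (card V)"
  define \<phi> where "\<phi> = real (min_balanced_cut V E)"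
  define p where "p = 0.5 / d"
  \<comment> \<open>The probability that an edge is sampled and carries the bit 1.\<close>
  define q where "q = p / 2"
  have V: "finite V" "V \<noteq> {}" and E2: "\<forall>e\<in>E. e \<subseteq> V \<and> card e = 2"
    using assms(1) by (auto simp: connected_simple_graph_def)
  have finE: "finite E" using assms(2) by (intro card_ge_0_finite) simp
  have d: "d \<ge> 8" using assms(3) by (simp add: d_def)
  have p: "0 < p" "p < 1" using d by (auto simp: p_def field_simps)
  have q: "q = 1 / (4 * d)" "0 \<le> q" "q \<le> 1" using d by (auto simp: q_def p_def field_simps)
  \<comment> \<open>An edge provides two vertices, so \<open>log 2 n \<ge> 1\<close> and the bound
    on the minimum balanced cut yields \<open>10000 * d \<le> \<phi>\<close>.\<close>
  obtain e where "e \<in> E" using assms(2) by fastforce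
  then have "card V \<ge> 2" using E2 V by (metis card_mono)
  then have n: "n \<ge> 2" by (simp add: n_def)
  then have "log 2 n \<ge> 1" by simp
  then have "10000 * d * 1 \<le> 10000 * d * log 2 n" using d by (intro mult_left_mono) auto
  then have \<phi>: "10000 * d \<le> \<phi>" using assms(4) by (simp add: d_def n_def \<phi>_def)
  have HC: "finite (hierarchical_clusterings V)" by (rule finite_hierarchical_clusterings[OF V(1)])
  \<comment> \<open>The distribution of the tree given \<open>G\<close>; it does not depend on
    \<open>E'\<close>.\<close>
  define \<mu> where "\<mu> G = \<A> V E (indicator_weight E R G)" for G
  have w: "indicator_weight E R G \<in> edge_weights E" for G
    using assms(5) by (intro indicator_weight_mem) simp
  have \<mu>: "set_pmf (\<mu> G) \<subseteq> hierarchical_clusterings V" for G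
    using assms(6) w by (simp add: is_hc_algorithm_on_def \<mu>_def)
  have int: "integrable (\<mu> G) f" for G and f :: "'v hc_tree \<Rightarrow> real"
    using HC \<mu> by (intro integrable_measure_pmf_finite) (rule finite_subset)
  let ?A = "\<lambda>T. fst (H T)" and ?B = "\<lambda>T. snd (H T)"
  have bal: "balanced_cut V (?A T) (?B T)" if "T \<in> hierarchical_clusterings V" for T
    using assms(8) that unfolding is_HCToBC_def by (metis prod.collapse)
  have inj: "inj_on (lab E') E'" if "E' \<subseteq> E" for E'
    using assms(9) that by (auto simp: is_labelling_def bij_betw_def)
  let ?c = "\<lambda>E'. (p / 2) ^ card E' * (1 - p) ^ (card E - card E')"
  let ?sup = "\<lambda>G. {E'. G \<subseteq> E' \<and> E' \<subseteq> E}"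

  \<comment> \<open>Lower bound for the expected size of the reconstructed set\<close>
  have size: "expected_size (card E) (Rec_HC V E R \<A> H lab) \<ge> q * \<phi>"
  proof -
    have "expected_size (card E) (Rec_HC V E R \<A> H lab)
        = (\<Sum>G\<in>Pow E. \<Sum>E'\<in>?sup G. ?c E'
            * measure_pmf.expectation (\<mu> G) (\<lambda>T. real (card (cut_edges E' (?A T) (?B T)))))"
      unfolding expected_size_def p_def d_def \<mu>_def
    proof (rule expectation_Rec_HC[OF V(1) finE _ _ _ assms(6,9)])
      fix x E' T assume "E' \<subseteq> E"
      \<comment> \<open>Different edges have different labels, so \<open>I\<close> is as large as
        the set of sampled cut edges.\<close>
      then have "inj_on (lab E') (cut_edges E' (?A T) (?B T))"
        using inj by (auto simp: cut_edges_def intro: inj_on_subset)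
      then show "(case (x, lab E' ` cut_edges E' (?A T) (?B T), \<lambda>_. 0 :: nat) of
          (x, I, y) \<Rightarrow> real (card I)) = real (card (cut_edges E' (?A T) (?B T)))"
        by (simp add: card_image)
    qed (use p assms(5) in \<open>auto simp: p_def d_def\<close>)
    also have "\<dots> = (\<Sum>G\<in>Pow E. measure_pmf.expectation (\<mu> G)
        (\<lambda>T. \<Sum>E'\<in>?sup G. ?c E' * real (card (cut_edges E' (?A T) (?B T)))))"
      by (intro sum.cong refl) (simp add: Bochner_Integration.integral_sum int)
    \<comment> \<open>The bound is shown for every tree that may be returned, as its cut is balanced
      and has at least \<open>\<phi>\<close> edges of \<open>E\<close>; it then passes to the mean
      over trees.\<close>
    also have "\<dots> \<ge> (\<Sum>G\<in>Pow E. subset_prob q E G * (q * \<phi>))"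
    proof (rule sum_mono)
      fix G assume G: "G \<in> Pow E"
      have "subset_prob q E G * (q * \<phi>)
          \<le> (\<Sum>E'\<in>?sup G. ?c E' * real (card (cut_edges E' (?A T) (?B T))))"
        if "T \<in> set_pmf (\<mu> G)" for T
      proof -
        have "\<phi> \<le> real (card (cut_edges E (?A T) (?B T)))"
          using min_balanced_cut_le[OF V(1) finE bal] that \<mu> by (auto simp: \<phi>_def)
        then have "subset_prob q E G * (q * \<phi>)
            \<le> subset_prob q E G * (q * real (card (cut_edges E (?A T) (?B T))))"
          using q by (intro mult_left_mono subset_prob_nonneg) auto
        also have "\<dots> \<le> (\<Sum>E'\<in>?sup G. ?c E' * real (card (cut_edges E' (?A T) (?B T))))"
          using expected_new_cut_edges_ge[OF finE, of G p "?A T" "?B T"] G p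
          by (simp add: q_def mult_ac)
        finally show ?thesis .
      qed
      then show "subset_prob q E G * (q * \<phi>) \<le> measure_pmf.expectation (\<mu> G)
          (\<lambda>T. \<Sum>E'\<in>?sup G. ?c E' * real (card (cut_edges E' (?A T) (?B T))))"
        by (intro measure_pmf.integral_ge_const int) (auto simp: AE_measure_pmf_iff)
    qed
    also have "(\<Sum>G\<in>Pow E. subset_prob q E G * (q * \<phi>)) = q * \<phi>"
      using finE by (simp add: sum_subset_prob flip: sum_distrib_right)
    finally show ?thesis .
  qed

  \<comment> \<open>Upper bound for the expected number of wrong guesses\<close>
  have errors: "expected_errors (card E) (Rec_HC V E R \<A> H lab)
      \<le> 27 / (16 * n) * (n / 3 + n * \<phi> / (400 * d))"
  proof -
    let ?X = "\<lambda>G. measure_pmf.expectation (\<mu> G) (\<lambda>T. real (card (cut_edges G (?A T) (?B T))))"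
    let ?opt = "\<lambda>G. Min (hc_cost E (indicator_weight E R G) ` hierarchical_clusterings V)"
    have "expected_errors (card E) (Rec_HC V E R \<A> H lab) = (\<Sum>G\<in>Pow E. \<Sum>E'\<in>?sup G. ?c E' * ?X G)"
      unfolding expected_errors_def p_def d_def \<mu>_def
    proof (rule expectation_Rec_HC[OF V(1) finE _ _ _ assms(6,9)])
      fix x E' T assume x: "x \<in> bit_strings (card E)" and E': "E' \<subseteq> E"
      let ?D = "cut_edges {e\<in>E'. x (lab E' e) = 1} (?A T) (?B T)"
      have "x (lab E' e) \<in> {0, 1}" if "e \<in> E'" for e
      proof -
        have "lab E' e \<in> {1..card E'}"
          using assms(9) E' that unfolding is_labelling_def bij_betw_def by blast
        then show ?thesis
          using x card_mono[OF finE E'] by (auto simp: bit_strings_def PiE_iff)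
      qed
      \<comment> \<open>All guesses are 0, so the errors are exactly the cut edges of
        \<open>G\<close>.\<close>
      then have "{e \<in> cut_edges E' (?A T) (?B T). x (lab E' e) \<noteq> 0} = ?D"
        by (fastforce simp: cut_edges_def)
      then have "{i \<in> lab E' ` cut_edges E' (?A T) (?B T). x i \<noteq> 0} = lab E' ` ?D"
        by blast
      moreover have "inj_on (lab E') ?D"
        using inj[OF E'] by (auto simp: cut_edges_def intro: inj_on_subset)
      ultimately show "(case (x, lab E' ` cut_edges E' (?A T) (?B T), \<lambda>_. 0 :: nat) of
          (x, I, y) \<Rightarrow> real (card {i\<in>I. x i \<noteq> y i})) = real (card ?D)"
        by (simp add: card_image)
    qed (use p assms(5) in \<open>auto simp: p_def d_def\<close>)
    \<comment> \<open>\<open>?X G\<close> is free of \<open>E'\<close>, so summing over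
      \<open>E'\<close> leaves the probability of \<open>G\<close>, with
      \<open>p / 2 + (1 - p) = 1 - q\<close>.\<close>
    also have "\<dots> = (\<Sum>G\<in>Pow E. subset_prob q E G * ?X G)"
      using finE by (intro sum.cong refl)
        (simp add: sum_supersets_power_card subset_prob_def q_def flip: sum_distrib_right)
    also have "\<dots> \<le> (\<Sum>G\<in>Pow E. subset_prob q E G
        * (27 / (16 * n * R) * (?opt G + R * (n * \<phi> / (400 * d)))))"
    proof (intro sum_mono mult_left_mono)
      fix G assume G: "G \<in> Pow E"
      have "?X G \<le> measure_pmf.expectation (\<mu> G)
          (\<lambda>T. 27 / (16 * n * R) * hc_cost E (indicator_weight E R G) T)"
      proof (intro integral_mono_AE int, unfold AE_measure_pmf_iff, intro ballI)
        fix T assume "T \<in> set_pmf (\<mu> G)"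
        then have "R * real (card (cut_edges G (?A T) (?B T)))
            \<le> 27 / (16 * n) * hc_cost E (indicator_weight E R G) T"
          unfolding n_def using \<mu> G by (intro card_cut_edges_le_hc_cost V finE assms) auto
        then show "real (card (cut_edges G (?A T) (?B T)))
            \<le> 27 / (16 * n * R) * hc_cost E (indicator_weight E R G) T"
          using assms(5) n by (simp add: field_simps)
      qed
      also have "\<dots> = 27 / (16 * n * R)
          * measure_pmf.expectation (\<mu> G) (hc_cost E (indicator_weight E R G))"
        by simp
      \<comment> \<open>The additive error guarantee, applied to the weights that \<open>G\<close>
        determines.\<close>
      also have "\<dots> \<le> 27 / (16 * n * R) * (?opt G + R * (n * \<phi> / (400 * d)))"
        using assms(5,7) n w
        by (intro mult_left_mono) (auto simp: expected_additive_error_le_def \<mu>_def n_def \<phi>_def d_def)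
      finally show "?X G \<le> 27 / (16 * n * R) * (?opt G + R * (n * \<phi> / (400 * d)))" .
    qed (use q in \<open>auto intro: subset_prob_nonneg\<close>)
    also have "\<dots> = 27 / (16 * n * R) * ((\<Sum>G\<in>Pow E. subset_prob q E G * ?opt G)
        + (\<Sum>G\<in>Pow E. subset_prob q E G) * (R * (n * \<phi> / (400 * d))))"
      by (simp only: distrib_left mult.left_commute[of "subset_prob _ _ _"] sum.distrib
          sum_distrib_left[symmetric] sum_distrib_right[symmetric]) simp
    also have "\<dots> \<le> 27 / (16 * n * R) * (R * n / 3 + 1 * (R * (n * \<phi> / (400 * d))))"
      unfolding sum_subset_prob[OF finE]
      using expected_min_hc_cost_le[OF V finE _ E2, of R] assms(3,5) n
      by (intro mult_left_mono add_right_mono) (auto simp: q(1) d_def n_def)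
    also have "\<dots> = 27 / (16 * n) * (n / 3 + n * \<phi> / (400 * d))"
      using assms(5) n d by (simp add: field_simps)
    finally show ?thesis .
  qed

  \<comment> \<open>Comparison of errors and size\<close>
  have pos: "0 < q * \<phi>" using \<phi> d by (simp add: q(1))
  have "27 / (16 * n) * (n / 3 + n * \<phi> / (400 * d)) = 9 / 16 + 27 * \<phi> / (6400 * d)"
    using n d by (simp add: field_simps)
  \<comment> \<open>The right side is \<open>160 * \<phi> / (6400 * d)\<close>, so
    \<open>133 * \<phi> / (6400 * d)\<close> remains to absorb \<open>9 / 16\<close>, which
    \<open>10000 * d \<le> \<phi>\<close> ensures amply.\<close>
  also have "\<dots> \<le> 0.1 * (q * \<phi>)"
    using \<phi> d by (simp add: q(1) field_simps)
  finally have "expected_errors (card E) (Rec_HC V E R \<A> H lab)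
      \<le> 0.1 * expected_size (card E) (Rec_HC V E R \<A> H lab)"
    using errors size by linarith
  then have "expected_errors (card E) (Rec_HC V E R \<A> H lab)
      / expected_size (card E) (Rec_HC V E R \<A> H lab) \<le> 0.1"
    using size pos by (subst pos_divide_le_eq) auto
  \<comment> \<open>Here \<open>q * \<phi> = \<phi> / (4 * d)\<close>, twice the size that is
    claimed.\<close>
  moreover have "\<phi> / (8 * d) \<le> q * \<phi>"
    using \<phi> d by (simp add: q(1) field_simps)
  ultimately show ?thesis
    using size by (simp add: Succ_attack_def \<phi>_def d_def)
qed

end
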